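(* Let $p$ be an odd prime and let $f:\mathbb{F}_{p^{2k}}\to\mathbb{F}_p$ satisfy Condition A with sign $\epsilon$. Let $D_{\mathcal S}=\{x\in\mathbb{F}_{p^{2k}}^*: f(x)\text{ is a nonzero square in }\mathbb{F}_p\}$. Then $D_{\mathcal S}$ is a $(v,d,\lambda_1,\lambda_2)$ partial difference set in the additive group of $\mathbb{F}_{p^{2k}}$, where $v=p^{2k}$, $d=\frac12(p^k-p^{k-1})(p^k-\epsilon)$, $\lambda_1=\frac14(p^k-p^{k-1})^2-\frac{3\epsilon}{2}(p^k-p^{k-1})+\epsilon p^k$, $\lambda_2=\frac12(p^k-p^{k-1})\left(\frac12(p^k-p^{k-1})-\epsilon\right)$. Consequently the Cayley graph on $\mathbb{F}_{p^{2k}}$ generated by $D_{\mathcal S}$ is strongly regular with these parameters.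
   Context: Let $\zeta_p$ be a primitive complex $p$-th root of unity and $\mathrm{tr}$ the absolute trace from $\mathbb{F}_{p^{2k}}$ to $\mathbb{F}_p$. For $f:\mathbb{F}_{p^{2k}}\to\mathbb{F}_p$ the Walsh transform is $\mathcal{W}_f(b)=\sum_{x\in\mathbb{F}_{p^{2k}}}\zeta_p^{f(x)+\mathrm{tr}(bx)}$. Condition A: $p$ is an odd prime and $f:\mathbb{F}_{p^{2k}}\to\mathbb{F}_p$ satisfies $f(0)=0$, $f(-x)=f(x)$ for all $x$; there is an integer $l$ with $\gcd(l-1,p-1)=1$ such that $f(\alpha x)=\alpha^l f(x)$ for all $\alpha\in\mathbb{F}_p$, $x\in\mathbb{F}_{p^{2k}}$; and there exist a constant $\epsilon\in\{1,-1\}$ and a function $f^*:\mathbb{F}_{p^{2k}}\to\mathbb{F}_p$ such that $\mathcal{W}_f(b)=\epsilon p^k\zeta_p^{f^*(b)}$ for all $b\in\mathbb{F}_{p^{2k}}$. A $d$-subset $D$ of a finite abelian group $G$ (written additively, of order $v$) with $0\notin D$ is a $(v,d,\lambda,\mu)$ partial difference set if every nonzero element of $D$ can be written as $g-h$ with $g,h\in D$ in exactly $\lambda$ ways, and every nonzero element of $G\setminus D$ can be written so in exactly $\mu$ ways. The Cayley graph generated by a symmetric $D$ has vertex set $G$, with $x\sim y$ iff $x-y\in D$. *)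

theory Defs
  imports Complex_Main "HOL-Computational_Algebra.Primes"
begin

definition prime_subfield :: "nat \<Rightarrow> 'a::field set" where
  "prime_subfield p = {of_nat i | i. i < p}"

definition fp_ind :: "nat \<Rightarrow> 'a::field \<Rightarrow> nat" where
  "fp_ind p y = (THE i. i < p \<and> of_nat i = y)"

definition abs_trace :: "nat \<Rightarrow> nat \<Rightarrow> 'a::field \<Rightarrow> 'a" where
  "abs_trace p n x = (\<Sum>i<n. x ^ (p ^ i))"

definition walsh :: "complex \<Rightarrow> nat \<Rightarrow> nat \<Rightarrow> ('a::{field,finite} \<Rightarrow> 'a) \<Rightarrow> 'a \<Rightarrow> complex" where
  "walsh \<zeta> p n f b = (\<Sum>x\<in>UNIV. \<zeta> ^ (fp_ind p (f x + abs_trace p n (b * x))))"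

text \<open>Condition A for f : F_{p^{2k}} -> F_p with sign eps (zeta a primitive p-th root of unity).\<close>
definition conditionA :: "complex \<Rightarrow> nat \<Rightarrow> nat \<Rightarrow> ('a::{field,finite} \<Rightarrow> 'a) \<Rightarrow> int \<Rightarrow> bool" where
  "conditionA \<zeta> p k f \<epsilon> \<longleftrightarrow>
     prime p \<and> odd p \<and>
     (\<forall>x. f x \<in> prime_subfield p) \<and>
     f 0 = 0 \<and> (\<forall>x. f (- x) = f x) \<and>
     (\<exists>l::int. gcd (l - 1) (int p - 1) = 1 \<and>
        (\<forall>\<alpha>\<in>prime_subfield p. \<alpha> \<noteq> 0 \<longrightarrow> (\<forall>x. f (\<alpha> * x) = \<alpha> powi l * f x))) \<and>
     \<epsilon> \<in> {1, -1} \<and>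
     (\<exists>fs :: 'a \<Rightarrow> 'a. (\<forall>b. fs b \<in> prime_subfield p) \<and>
        (\<forall>b. walsh \<zeta> p (2*k) f b = of_int \<epsilon> * of_nat p ^ k * \<zeta> ^ (fp_ind p (fs b))))"

definition pds :: "'a::{ab_group_add,finite} set \<Rightarrow> real \<Rightarrow> real \<Rightarrow> real \<Rightarrow> real \<Rightarrow> bool" where
  "pds D v d lam mu \<longleftrightarrow>
     real (card (UNIV :: 'a set)) = v \<and> real (card D) = d \<and> 0 \<notin> D \<and>
     (\<forall>g\<in>D. real (card {(x, y). x \<in> D \<and> y \<in> D \<and> x - y = g}) = lam) \<and>
     (\<forall>g. g \<noteq> 0 \<and> g \<notin> D \<longrightarrow> real (card {(x, y). x \<in> D \<and> y \<in> D \<and> x - y = g}) = mu)"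

definition cayley_adj :: "'a::ab_group_add set \<Rightarrow> 'a \<Rightarrow> 'a \<Rightarrow> bool" where
  "cayley_adj D x y \<longleftrightarrow> x - y \<in> D"

definition srg :: "('a::finite \<Rightarrow> 'a \<Rightarrow> bool) \<Rightarrow> real \<Rightarrow> real \<Rightarrow> real \<Rightarrow> real \<Rightarrow> bool" where
  "srg E v d lam mu \<longleftrightarrow>
     (\<forall>x y. E x y \<longrightarrow> E y x) \<and> (\<forall>x. \<not> E x x) \<and>
     real (card (UNIV :: 'a set)) = v \<and>
     (\<forall>x. real (card {y. E x y}) = d) \<and>
     (\<forall>x y. x \<noteq> y \<and> E x y \<longrightarrow> real (card {z. E x z \<and> E y z}) = lam) \<and>
     (\<forall>x y. x \<noteq> y \<and> \<not> E x y \<longrightarrow> real (card {z. E x z \<and> E y z}) = mu)"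

end

(*
  Write S for the nonzero squares of F_p and chi(x) = zeta^tr(x). Irreducibility of
  the p-th cyclotomic polynomial allows zeta to be replaced by zeta^a in the Walsh
  transform for every a in F_p^*. Substituting x -> beta x with a = beta^(1-l), which
  is possible because l - 1 is coprime to p - 1, then gives
    sum_x zeta^(a f(x)) chi(b x) = eps p^k zeta^(beta f*(b)).
  Expanding the indicator function of S in additive characters of F_p and using that
  l is even, the character sum of D_S at b is
    eps p^(k-1) (p [f*(b) in S] - (p-1)/2) + [b = 0] p^(2k-1) (p-1)/2.
  Since f*(0) = 0, it takes two values for b <> 0 and so satisfies a quadratic
  equation there; Fourier inversion turns this into the difference counts.
*)
theory Submission
  imports Defs "HOL-Number_Theory.Number_Theory" "HOL-Computational_Algebra.Computational_Algebra"
begin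

section \<open>Irreducibility of the \<open>p\<close>-th cyclotomic polynomial and conjugate roots
  of unity\<close>

abbreviation ipoly :: "int poly \<Rightarrow> 'b::comm_ring_1 poly" where
  "ipoly \<equiv> map_poly of_int"

lemma ipoly_add: "ipoly (g + h) = ipoly g + ipoly h"
  by (rule poly_eqI) (simp add: coeff_map_poly)

lemma ipoly_diff: "ipoly (g - h) = ipoly g - ipoly h"
  by (rule poly_eqI) (simp add: coeff_map_poly)

lemma ipoly_mult: "ipoly (g * h) = ipoly g * ipoly h"
  by (rule poly_eqI) (simp add: coeff_map_poly coeff_mult)

lemma ipoly_smult: "ipoly (smult c g) = smult (of_int c) (ipoly g)"
  by (rule poly_eqI) (simp add: coeff_map_poly)

lemma poly_ipoly_of_int: "poly (ipoly g) (of_int c) = of_int (poly g c)"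
  by (induction g) (simp_all add: map_poly_pCons)

lemma ipoly_power: "ipoly (g ^ n) = ipoly g ^ n"
  by (induction n) (simp_all add: ipoly_mult)

lemma ipoly_sum: "ipoly (\<Sum>i\<in>I. g i) = (\<Sum>i\<in>I. ipoly (g i))"
  by (induction I rule: infinite_finite_induct) (simp_all add: ipoly_add)

text \<open>A leading coefficient of 1 or -1 stays nonzero in every characteristic, so reduction
  modulo \<open>p\<close> loses no degree.\<close>

lemma degree_ipoly: "\<bar>lead_coeff g\<bar> = 1 \<Longrightarrow> degree (ipoly g :: 'b::comm_ring_1 poly) = degree g"
  by (rule map_poly_degree_eq) (auto simp: abs_if split: if_splits)

text \<open>For prime \<open>n\<close> this is the \<open>n\<close>-th cyclotomic polynomial. It is
  polymorphic because it is used over the integers, over the complex numbers and in characteristic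
  \<open>p\<close>.\<close>

definition geom_poly :: "nat \<Rightarrow> 'b::comm_ring_1 poly" where
  "geom_poly n = (\<Sum>i<n. [:0, 1:] ^ i)"

lemma geom_poly_mult: "[:-1, 1:] * geom_poly n = [:0, 1:] ^ n - (1 :: 'b::comm_ring_1 poly)"
  using power_diff_1_eq[of "[:0, 1:] :: 'b poly" n] by (simp add: geom_poly_def one_pCons)

lemma poly_geom_poly: "poly (geom_poly n) x = (\<Sum>i<n. x ^ i)"
  by (simp add: geom_poly_def poly_sum)

lemma ipoly_geom_poly: "ipoly (geom_poly n) = geom_poly n"
  by (simp add: geom_poly_def ipoly_sum ipoly_power map_poly_pCons)

lemma lead_coeff_geom_poly:
  assumes "n > 0"
  shows "lead_coeff (geom_poly n :: 'b::idom poly) = 1"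
proof -
  have "degree ([:0, 1:] ^ n - 1 :: 'b poly) = n"
    using degree_add_eq_left[of "-1" "[:0, 1:] ^ n :: 'b poly"] assms by (simp add: degree_power_eq)
  then have "lead_coeff ([:0, 1:] ^ n - 1 :: 'b poly) = 1"
    using assms by (simp add: coeff_linear_power)
  then show ?thesis
    unfolding geom_poly_mult [symmetric] lead_coeff_mult by simp
qed

text \<open>The Frobenius identity gives \<open>(X - 1)^p = X^p - 1\<close>, with oddness of
  \<open>p\<close> fixing the sign; cancelling one factor \<open>X - 1\<close> leaves the
  claim.\<close>

lemma geom_poly_CHAR:
  assumes "prime p" "odd p" "CHAR('b::field) = p"
  shows "geom_poly p = ([:-1, 1:] :: 'b poly) ^ (p - 1)"
proof -
  have "([:0, 1:] + [:-1:] :: 'b poly) ^ p = [:0, 1:] ^ p + [:-1:] ^ p"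
    by (rule freshmans_dream) (use assms in simp_all)
  moreover have "[:-1:] ^ p = (-1 :: 'b poly)"
    using assms by (simp add: one_pCons poly_const_pow)
  ultimately have "[:-1, 1:] ^ p = [:0, 1:] ^ p - (1 :: 'b poly)"
    by simp
  moreover have "[:-1, 1:] ^ p = [:-1, 1:] * ([:-1, 1:] :: 'b poly) ^ (p - 1)"
    using prime_gt_0_nat[OF assms(1)] by (simp add: power_eq_if)
  ultimately have "[:-1, 1:] * geom_poly p = [:-1, 1:] * ([:-1, 1:] :: 'b poly) ^ (p - 1)"
    by (simp only: geom_poly_mult)
  then show ?thesis
    by (simp only: mult_cancel_left) simp
qed

text \<open>The order at \<open>c\<close> of each factor is at most its degree, while orders and
  degrees both add up to \<open>m\<close>. So both bounds are attained, and \<open>g\<close> has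
  positive order at \<open>c\<close>.\<close>

lemma factor_linear_power_root:
  fixes g h :: "'b::field poly"
  assumes "g * h = [:-c, 1:] ^ m" "degree g > 0"
  shows "poly g c = 0"
proof -
  have nz: "g * h \<noteq> 0"
    using assms(1) by simp
  have "order c g + order c h = m"
    using order_mult[OF nz, of c] assms(1) order_power_n_n[of c m] by simp
  moreover have "degree g + degree h = m"
    using nz degree_mult_eq[of g h] degree_linear_power[of "-c" m] unfolding assms(1)[symmetric] by auto
  moreover have "order c g \<le> degree g" "order c h \<le> degree h"
    using nz by (auto intro!: order_degree)
  ultimately have "order c g > 0"
    using assms(2) by simp
  then show ?thesis
    by (simp add: order_root)
qed

text \<open>Modulo \<open>p\<close> the polynomial is \<open>(X - 1) ^ (p - 1)\<close>, so two nonconstant factors would both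
  vanish at 1 modulo \<open>p\<close> (Eisenstein's argument), whereas the value at 1 is only \<open>p\<close>.\<close>
lemma geom_poly_factor_is_unit:
  fixes g h :: "int poly"
  assumes p: "prime p" "odd p" "CHAR('b::field) = p" and gh: "geom_poly p = g * h" and deg: "degree g > 0"
  shows "is_unit h"
proof -
  have p0: "p > 0"
    using p(1) prime_gt_0_nat by blast
  have "lead_coeff g * lead_coeff h = 1"
    using lead_coeff_geom_poly[OF p0, where 'b=int] by (simp add: gh lead_coeff_mult)
  then have lc: "\<bar>lead_coeff g\<bar> = 1" "\<bar>lead_coeff h\<bar> = 1"
    by (metis abs_1 abs_zmult_eq_1 mult.commute)+
  have "degree h = 0"
  proof (rule ccontr)
    assume "degree h \<noteq> 0"
    have "geom_poly p = (ipoly g * ipoly h :: 'b poly)"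
      by (simp add: ipoly_geom_poly flip: ipoly_mult gh)
    then have fac: "ipoly g * ipoly h = ([:-1, 1:] :: 'b poly) ^ (p - 1)"
      using geom_poly_CHAR[OF p] by simp
    have "poly (ipoly g) (1::'b) = 0"
      by (rule factor_linear_power_root[OF fac]) (use deg lc in \<open>simp add: degree_ipoly\<close>)
    moreover have "poly (ipoly h) (1::'b) = 0"
      by (rule factor_linear_power_root[of _ "ipoly g"])
         (use fac lc \<open>degree h \<noteq> 0\<close> in \<open>simp_all add: degree_ipoly mult.commute\<close>)
    moreover have "int p dvd poly r 1" if "poly (ipoly r) (1::'b) = 0" for r
      proof -
      have "of_int (poly r 1) = (of_int 0 :: 'b)"
        using that poly_ipoly_of_int[of r 1, where ?'a = 'b] by simp
      then have "[poly r 1 = 0] (mod int CHAR('b))"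
        by (simp only: of_int_eq_iff_cong_CHAR)
      then show ?thesis
        by (simp add: cong_0_iff p)
    qed
    ultimately have "int p dvd poly g 1" "int p dvd poly h 1"
      by blast+
    then have "int p * int p dvd poly (g * h) 1"
      by (simp add: mult_dvd_mono)
    then have "int p * int p dvd int p"
      by (simp add: poly_geom_poly flip: gh)
    then show False
      using p(1) p0 by (auto simp: prime_nat_iff dest!: zdvd_imp_le)
  qed
  then obtain c where "h = [:c:]"
    by (rule degree_eq_zeroE)
  with lc show ?thesis
    by (simp add: is_unit_const_poly_iff)
qed

text \<open>An integer polynomial of least degree vanishing at \<zeta> divides
  \<open>geom_poly p\<close>, and irreducibility makes it an associate. The type \<open>'b\<close>
  supplies a field of characteristic \<open>p\<close> for the reduction argument.\<close>

lemma geom_poly_dvd: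
  fixes \<zeta> :: complex
  assumes p: "prime p" "odd p" "CHAR('b::field) = p" and \<zeta>: "\<zeta> ^ p = 1" "\<zeta> \<noteq> 1"
    and root: "poly (ipoly h) \<zeta> = 0"
  shows "geom_poly p dvd h"
proof -
  define V where "V = (\<lambda>g :: int poly. g \<noteq> 0 \<and> poly (ipoly g) \<zeta> = 0)"
  have p0: "p > 0"
    using p(1) prime_gt_0_nat by blast
  have "geom_poly p \<noteq> (0 :: int poly)"
    using lead_coeff_geom_poly[OF p0, where 'b=int] by auto
  moreover have "(\<Sum>i<p. \<zeta> ^ i) = 0"
    using power_diff_1_eq[of \<zeta> p] \<zeta> by simp
  ultimately have Vgeom: "V (geom_poly p)"
    by (simp add: V_def ipoly_geom_poly poly_geom_poly)
  then obtain g0 where g0: "V g0" "\<And>g. V g \<Longrightarrow> degree g0 \<le> degree g"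
    using ex_has_least_nat[of V _ degree] by blast
  \<comment> \<open>By Gauss's lemma a primitive \<open>g\<close> of least degree divides every integer polynomial vanishing at \<open>\<zeta>\<close>.\<close>
  define g where "g = primitive_part g0"
  have "g0 = smult (content g0) g"
    by (simp add: g_def)
  then have "poly (ipoly g0) \<zeta> = of_int (content g0) * poly (ipoly g) \<zeta>"
    by (metis ipoly_smult poly_smult)
  then have Vg: "V g" "content g = 1"
    using g0(1) by (auto simp: V_def g_def)
  have g_min: "degree g \<le> degree r" if "V r" for r
    using g0(2)[OF that] by (simp add: g_def)
  have g_dvd: "g dvd r" if r: "poly (ipoly r) \<zeta> = 0" for r
  proof (cases "r = 0")
    case False
    \<comment> \<open>Over the integers, division with remainder requires scaling \<open>r\<close>
      by some nonzero \<open>a\<close>; minimality of the degree then kills the remainder.\<close>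
    obtain a q where a: "a \<noteq> 0" "smult a r = g * q + pseudo_mod r g"
      using pseudo_mod(1)[of g r] Vg by (auto simp: V_def)
    have "poly (ipoly (smult a r)) \<zeta> = 0"
      by (simp add: ipoly_smult r)
    then have "poly (ipoly (pseudo_mod r g)) \<zeta> = 0"
      using Vg unfolding a(2) by (simp add: ipoly_add ipoly_mult V_def)
    then have "pseudo_mod r g = 0"
      using pseudo_mod(2)[of g r] g_min[of "pseudo_mod r g"] Vg unfolding V_def by fastforce
    \<comment> \<open>Primitive parts are multiplicative, so passing to them shrinks the scaling
      factor \<open>a\<close> to its sign.\<close>
    then have "primitive_part (smult a r) = primitive_part g * primitive_part q"
      by (simp add: a(2) primitive_part_mult)
    moreover have "primitive_part g = g"
      using content_times_primitive_part[of g] Vg(2) by simp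
    ultimately have "smult (unit_factor a) (primitive_part r) = g * primitive_part q"
      by (simp add: primitive_part_smult)
    then have "g dvd smult (unit_factor a) (primitive_part r)"
      by simp
    then have "g dvd primitive_part r"
      using a(1) by (cases "a > 0") simp_all
    then show ?thesis
      by (metis content_times_primitive_part dvd_smult)
  qed simp
  obtain n where n: "geom_poly p = g * n"
    using g_dvd[of "geom_poly p"] Vgeom by (auto simp: V_def)
  have "degree g > 0"
  proof (rule ccontr)
    assume "\<not> degree g > 0"
    then obtain c where "g = [:c:]"
      using degree_eq_zeroE by blast
    then show False
      using Vg by (auto simp: V_def map_poly_pCons)
  qed
  then have "is_unit n"
    using geom_poly_factor_is_unit[OF p n] by simp
  then show ?thesis
    using g_dvd[OF root] n by (simp add: mult_unit_dvd_iff)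
qed

text \<open>With \<open>u\<close> an inverse of \<open>t\<close> modulo \<open>p\<close>, the power
  \<open>(\<zeta> ^ t) ^ u\<close> is \<zeta> again.\<close>

lemma root_of_unity_power_neq_1:
  fixes \<zeta> :: complex
  assumes "prime p" and \<zeta>: "\<zeta> ^ p = 1" "\<zeta> \<noteq> 1" and "\<not> p dvd t"
  shows "\<zeta> ^ t \<noteq> 1"
proof
  assume "\<zeta> ^ t = 1"
  have "coprime t p"
    using prime_imp_coprime[OF assms(1,4)] by (simp add: coprime_commute)
  then obtain u where "[t * u = 1] (mod p)"
    using cong_solve_coprime_nat[of t p] by auto
  then have *: "t * u mod p = 1"
    using prime_gt_1_nat[OF assms(1)] by (simp add: cong_def)
  have "\<zeta> = \<zeta> ^ (p * (t * u div p) + t * u mod p)"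
    by (simp only: power_add power_mult \<zeta> power_one *) simp
  also have "\<dots> = (\<zeta> ^ t) ^ u"
    by (simp only: mult_div_mod_eq power_mult)
  finally show False
    using \<open>\<zeta> ^ t = 1\<close> \<zeta> by simp
qed

text \<open>The cyclotomic polynomial divides \<open>h\<close> and also vanishes at
  \<open>\<zeta> ^ t\<close>. This replaces a Galois automorphism: integer relations in \<zeta>
  persist for its conjugates.\<close>

lemma root_of_unity_conjugate:
  fixes \<zeta> :: complex
  assumes p: "prime p" "odd p" "CHAR('b::field) = p" and \<zeta>: "\<zeta> ^ p = 1" "\<zeta> \<noteq> 1"
    and root: "poly (ipoly h) \<zeta> = 0" and t: "\<not> p dvd t"
  shows "poly (ipoly h) (\<zeta> ^ t) = 0"
proof -
  obtain q where "h = geom_poly p * q"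
    using geom_poly_dvd[OF p \<zeta> root] by blast
  moreover have "(\<zeta> ^ t) ^ p = 1"
    using \<zeta>(1) by (metis mult.commute power_mult power_one)
  then have "(\<Sum>i<p. (\<zeta> ^ t) ^ i) = 0"
    using power_diff_1_eq[of "\<zeta> ^ t" p] root_of_unity_power_neq_1[OF p(1) \<zeta> t] by simp
  ultimately show ?thesis
    by (simp add: ipoly_mult ipoly_geom_poly poly_geom_poly)
qed

section \<open>The field of order \<open>p ^ n\<close> and its prime subfield\<close>

locale prime_power_field =
  fixes p n :: nat and \<zeta> :: complex and P :: "'a::{field,finite} set"
  assumes p_prime: "prime p" and p_odd: "odd p"
    and card_UNIV: "card (UNIV :: 'a set) = p ^ n"
    and zeta: "\<zeta> ^ p = 1" "\<zeta> \<noteq> 1"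
    and P_def: "P = prime_subfield p"
begin

lemma p_pos: "p > 0"
  using p_prime prime_gt_0_nat by blast

lemma n_pos: "n > 0"
proof (rule ccontr)
  assume "\<not> n > 0"
  then have "card (UNIV :: 'a set) = 1"
    using card_UNIV by simp
  then obtain x where "(UNIV :: 'a set) = {x}"
    using card_1_singletonE by blast
  then show False
    using zero_neq_one[where 'a='a] by (metis UNIV_I singletonD)
qed

lemma CHAR_eq: "CHAR('a) = p"
proof -
  have "prime CHAR('a)"
    using finite_imp_CHAR_pos[where 'a='a] prime_CHAR_semidom[where 'a='a] by simp
  moreover have "CHAR('a) dvd p ^ n"
    using CHAR_dvd_CARD[where 'a='a] card_UNIV by simp
  ultimately show ?thesis
    using p_prime by (metis prime_dvd_power primes_dvd_imp_eq)
qed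

lemma frobenius_add: "(x + y :: 'a) ^ p ^ i = x ^ p ^ i + y ^ p ^ i"
  by (rule freshmans_dream') (simp_all add: CHAR_eq p_prime)

lemma frobenius_sum: "(\<Sum>i\<in>I. x i :: 'a) ^ p = (\<Sum>i\<in>I. x i ^ p)"
  by (rule freshmans_dream_sum) (simp_all add: CHAR_eq p_prime)

lemma power_card: "(x :: 'a) ^ p ^ n = x"
proof (cases "x = 0")
  case False
  \<comment> \<open>Multiplication by \<open>x\<close> permutes the nonzero elements, so their
    product absorbs the power of \<open>x\<close>.\<close>
  have "(\<Prod>y\<in>UNIV-{0}. x * y) = (\<Prod>y\<in>UNIV-{0}. y)"
    by (rule prod.reindex_bij_witness[of _ "\<lambda>y. y / x" "\<lambda>y. x * y"]) (use False in auto)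
  then have "x ^ (p ^ n - 1) * (\<Prod>y\<in>UNIV-{0::'a}. y) = (\<Prod>y\<in>UNIV-{0}. y)"
    by (simp add: prod.distrib card_Diff_singleton card_UNIV)
  then have "x ^ (p ^ n - 1) = 1"
    by simp
  then show ?thesis
    using p_pos by (metis mult.right_neutral power_minus_mult zero_less_power mult.commute)
qed (use p_pos in \<open>simp add: power_0_left\<close>)

lemma of_nat_eq_iff_mod: "(of_nat i :: 'a) = of_nat j \<longleftrightarrow> i mod p = j mod p"
  using of_nat_eq_iff_cong_CHAR[of i j, where 'a='a] by (simp add: CHAR_eq cong_def)

lemma of_nat_mod: "(of_nat (i mod p) :: 'a) = of_nat i"
  by (simp add: of_nat_eq_iff_mod)

lemma of_nat_power_p: "(of_nat i :: 'a) ^ p = of_nat i"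
  using frobenius_add[of _ _ 1] p_pos by (induction i) (simp_all add: power_0_left)

lemma card_P: "card P = p"
proof -
  have "P = of_nat ` {..<p}"
    by (auto simp: P_def prime_subfield_def)
  moreover have "inj_on (of_nat :: nat \<Rightarrow> 'a) {..<p}"
    by (auto simp: inj_on_def of_nat_eq_iff_mod)
  ultimately show ?thesis
    by (simp add: card_image)
qed

text \<open>The \<open>p\<close> elements of \<open>P\<close> are roots of \<open>X^p - X\<close>,
  which has no room for more. Closure of \<open>P\<close> under the field operations becomes a
  computation with \<open>p\<close>-th powers.\<close>

lemma P_iff: "y \<in> P \<longleftrightarrow> y ^ p = y"
proof -
  let ?h = "[:0, 1:] ^ p + [:0, -1:] :: 'a poly"
  have deg: "degree ?h = p"
    using prime_gt_1_nat[OF p_prime] by (subst degree_add_eq_left) (simp_all add: degree_power_eq)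
  then have "?h \<noteq> 0"
    using p_pos by (metis degree_0 less_irrefl)
  then have "card {y. poly ?h y = 0} \<le> p"
    using card_poly_roots_bound[of ?h] deg by simp
  then have "card {y :: 'a. y ^ p = y} \<le> card P"
    by (simp add: card_P)
  moreover have "P \<subseteq> {y. y ^ p = y}"
    by (auto simp: P_def prime_subfield_def of_nat_power_p)
  ultimately have "P = {y. y ^ p = y}"
    by (intro card_seteq) simp_all
  then show ?thesis
    by blast
qed

lemma P_0 [simp]: "0 \<in> P" and P_1 [simp]: "1 \<in> P"
  using p_pos by (simp_all add: P_iff power_0_left)

lemma P_add [simp]: "y \<in> P \<Longrightarrow> z \<in> P \<Longrightarrow> y + z \<in> P"
  using frobenius_add[of y z 1] by (simp add: P_iff)

lemma P_mult [simp]: "y \<in> P \<Longrightarrow> z \<in> P \<Longrightarrow> y * z \<in> P"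
  by (simp add: P_iff power_mult_distrib)

lemma P_uminus [simp]: "y \<in> P \<Longrightarrow> - y \<in> P"
  using p_odd by (simp add: P_iff)

lemma P_diff [simp]: "y \<in> P \<Longrightarrow> z \<in> P \<Longrightarrow> y - z \<in> P"
  using P_add[of y "- z"] by simp

lemma P_divide [simp]: "y \<in> P \<Longrightarrow> z \<in> P \<Longrightarrow> y / z \<in> P"
  by (simp add: P_iff power_divide)

lemma P_power [simp]: "y \<in> P \<Longrightarrow> y ^ i \<in> P"
  by (induction i) simp_all

lemma P_power_int [simp]: "y \<in> P \<Longrightarrow> y powi i \<in> P"
  using P_divide[of 1 "y ^ nat (- i)"] by (simp add: power_int_def inverse_eq_divide power_one_over)

lemma P_cases:
  assumes "y \<in> P"
  obtains i where "i < p" "y = of_nat i"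
  using assms by (auto simp: P_def prime_subfield_def)

section \<open>The additive character of the prime subfield and its conjugates\<close>

definition \<psi> :: "'a \<Rightarrow> complex" where
  "\<psi> y = \<zeta> ^ fp_ind p y"

lemma fp_ind_of_nat: "fp_ind p (of_nat i :: 'a) = i mod p"
  unfolding fp_ind_def using p_pos by (intro the_equality) (auto simp: of_nat_eq_iff_mod)

lemma of_nat_fp_ind: "y \<in> P \<Longrightarrow> of_nat (fp_ind p y) = y"
  by (auto elim!: P_cases simp: fp_ind_of_nat of_nat_mod)

lemma psi_of_nat: "\<psi> (of_nat i) = \<zeta> ^ i"
proof -
  have "\<zeta> ^ i = \<zeta> ^ (p * (i div p) + i mod p)"
    by simp
  also have "\<dots> = \<zeta> ^ (i mod p)"
    by (simp only: power_add power_mult zeta power_one) simp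
  finally show ?thesis
    by (simp add: \<psi>_def fp_ind_of_nat)
qed

lemma psi_0 [simp]: "\<psi> 0 = 1" and psi_1 [simp]: "\<psi> 1 = \<zeta>"
  using psi_of_nat[of 0] psi_of_nat[of 1] by simp_all

lemma psi_add: "y \<in> P \<Longrightarrow> z \<in> P \<Longrightarrow> \<psi> (y + z) = \<psi> y * \<psi> z"
  by (elim P_cases) (simp add: psi_of_nat power_add flip: of_nat_add)

text \<open>This is the action of the Galois automorphism \<open>\<zeta> \<mapsto> \<zeta> ^ t\<close>.\<close>
lemma psi_sum_scale:
  assumes "finite X" and uP: "\<And>x. x \<in> X \<Longrightarrow> u x \<in> P" and "w \<in> P"
    and sum: "(\<Sum>x\<in>X. \<psi> (u x)) = of_int c * \<psi> w" and \<alpha>: "\<alpha> \<in> P" "\<alpha> \<noteq> 0"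
  shows "(\<Sum>x\<in>X. \<psi> (\<alpha> * u x)) = of_int c * \<psi> (\<alpha> * w)"
proof -
  obtain t where t: "t < p" "\<alpha> = of_nat t"
    using \<alpha>(1) by (rule P_cases)
  have "\<not> p dvd t"
    using t \<alpha>(2) of_nat_eq_iff_mod[of t 0] by auto
  \<comment> \<open>The hypothesis says that this integer polynomial vanishes at \<zeta>; its
    vanishing at \<open>\<zeta> ^ t\<close> is the conclusion. The factor \<open>c\<close> must be
    an integer to be left unchanged.\<close>
  define h where "h = (\<Sum>x\<in>X. [:0, 1:] ^ fp_ind p (u x)) - smult c ([:0, 1:] ^ fp_ind p w)"
  have h: "poly (ipoly h) z = (\<Sum>x\<in>X. z ^ fp_ind p (u x)) - of_int c * z ^ fp_ind p w" for z :: complex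
    by (simp add: h_def ipoly_diff ipoly_sum ipoly_smult ipoly_power map_poly_pCons poly_sum)
  have "poly (ipoly h) (\<zeta> ^ t) = 0"
    by (rule root_of_unity_conjugate[OF p_prime p_odd CHAR_eq zeta _ \<open>\<not> p dvd t\<close>])
       (use sum in \<open>simp add: h \<psi>_def\<close>)
  moreover have "(\<zeta> ^ t) ^ fp_ind p y = \<psi> (\<alpha> * y)" if "y \<in> P" for y
    using psi_of_nat[of "t * fp_ind p y"] that by (simp add: t of_nat_fp_ind power_mult)
  ultimately show ?thesis
    using uP \<open>w \<in> P\<close> by (simp add: h)
qed

section \<open>The trace, the characters of the whole field and Fourier inversion\<close>

definition tr :: "'a \<Rightarrow> 'a" where
  "tr = abs_trace p n"

lemma tr_add: "tr (x + y) = tr x + tr y"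
  by (simp add: tr_def abs_trace_def frobenius_add sum.distrib)

lemma tr_0 [simp]: "tr 0 = 0"
  using p_pos by (simp add: tr_def abs_trace_def power_0_left)

text \<open>Raising to the \<open>p\<close>-th power shifts the summation index by one, and
  \<open>power_card\<close> closes the cycle.\<close>

lemma tr_P [simp]: "tr x \<in> P"
proof -
  have "tr x ^ p = (\<Sum>i<n. x ^ p ^ Suc i)"
    unfolding tr_def abs_trace_def frobenius_sum by (simp add: mult.commute flip: power_mult)
  also have "x + \<dots> = (\<Sum>i<Suc n. x ^ p ^ i)"
    by (simp only: sum.lessThan_Suc_shift) simp
  also have "\<dots> = tr x + x"
    by (simp add: tr_def abs_trace_def power_card)
  finally show ?thesis
    by (simp add: P_iff)
qed

lemma tr_scale:
  assumes "\<alpha> \<in> P"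
  shows "tr (\<alpha> * x) = \<alpha> * tr x"
proof -
  have "\<alpha> ^ p ^ i = \<alpha>" for i
    using assms by (induction i) (simp_all add: P_iff power_mult)
  then show ?thesis
    by (simp add: tr_def abs_trace_def power_mult_distrib sum_distrib_left)
qed

text \<open>The trace is a nonzero polynomial of degree at most \<open>p ^ (n - 1)\<close>, too
  small to vanish on the whole field.\<close>

lemma tr_nonzero: "\<exists>x. tr x \<noteq> 0"
proof (rule ccontr)
  assume no: "\<not> (\<exists>x. tr x \<noteq> 0)"
  define h where "h = (\<Sum>i<n. monom (1 :: 'a) (p ^ i))"
  have p1: "p > 1"
    using p_prime prime_gt_1_nat by blast
  \<comment> \<open>Only the summand \<open>i = 0\<close> contributes in degree 1, which witnesses
    \<open>h \<noteq> 0\<close>.\<close>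
  have "coeff h 1 = (\<Sum>i<n. if i = 0 then 1 else 0)"
    unfolding h_def coeff_sum by (rule sum.cong) (use p1 in \<open>auto simp: coeff_monom\<close>)
  also have "\<dots> = 1"
    using n_pos by simp
  finally have "h \<noteq> 0"
    by auto
  have "poly h x = 0" for x
    using no by (simp add: h_def poly_sum poly_monom tr_def abs_trace_def)
  then have "p ^ n \<le> degree h"
    using card_poly_roots_bound[OF \<open>h \<noteq> 0\<close>] by (simp add: card_UNIV)
  also have "degree h \<le> p ^ (n - 1)"
    unfolding h_def
    by (rule degree_sum_le) (use p1 in \<open>auto intro!: order.trans[OF degree_monom_le] power_increasing\<close>)
  also have "\<dots> < p ^ n"
    using p1 n_pos by (intro power_strict_increasing) auto
  finally show False
    by simp
qed

definition \<chi> :: "'a \<Rightarrow> complex" where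
  "\<chi> x = \<psi> (tr x)"

lemma chi_0 [simp]: "\<chi> 0 = 1"
  by (simp add: \<chi>_def)

lemma chi_add: "\<chi> (x + y) = \<chi> x * \<chi> y"
  by (simp add: \<chi>_def tr_add psi_add)

lemma sum_psi:
  assumes "c \<in> P"
  shows "(\<Sum>\<alpha>\<in>P. \<psi> (\<alpha> * c)) = (if c = 0 then of_nat p else 0)"
proof (cases "c = 0")
  case False
  \<comment> \<open>The shift by \<open>1 / c\<close> multiplies the sum by
    \<open>\<psi> 1 = \<zeta>\<close>, which differs from 1, so the sum is 0.\<close>
  have "(\<Sum>\<alpha>\<in>P. \<psi> (\<alpha> * c)) = (\<Sum>\<alpha>\<in>P. \<psi> ((\<alpha> + 1 / c) * c))"
    by (rule sum.reindex_bij_witness[of _ "\<lambda>\<alpha>. \<alpha> + 1 / c" "\<lambda>\<alpha>. \<alpha> - 1 / c"]) (use assms in auto)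
  also have "\<dots> = (\<Sum>\<alpha>\<in>P. \<psi> (\<alpha> * c)) * \<zeta>"
    unfolding sum_distrib_right
    by (rule sum.cong) (use assms False in \<open>simp_all add: distrib_right psi_add\<close>)
  finally show ?thesis
    using zeta(2) False by simp
qed (simp add: card_P)

lemma sum_chi: "(\<Sum>b\<in>UNIV. \<chi> (b * x)) = (if x = 0 then of_nat (p ^ n) else 0)"
proof (cases "x = 0")
  case False
  obtain y where y: "tr y \<noteq> 0"
    using tr_nonzero by blast
  \<comment> \<open>Rescaling to trace 1 gives an element with \<open>\<chi> z = \<zeta>\<close>;
    the shift by \<open>z / x\<close> then works as in \<open>sum_psi\<close>.\<close>
  define z where "z = 1 / tr y * y"
  have "tr z = 1"
    unfolding z_def using y by (subst tr_scale) simp_all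
  then have z: "\<chi> z = \<zeta>"
    by (simp add: \<chi>_def)
  have "(\<Sum>b\<in>UNIV. \<chi> (b * x)) = (\<Sum>b\<in>UNIV. \<chi> ((b + z / x) * x))"
    by (rule sum.reindex_bij_witness[of _ "\<lambda>b. b + z / x" "\<lambda>b. b - z / x"]) auto
  also have "\<dots> = (\<Sum>b\<in>UNIV. \<chi> (b * x)) * \<zeta>"
    unfolding sum_distrib_right using False by (simp add: distrib_right chi_add z)
  finally show ?thesis
    using zeta(2) False by simp
qed (simp add: card_UNIV)

text \<open>After exchanging the sums, orthogonality in \<open>b\<close> leaves only
  \<open>x = g\<close>.\<close>

lemma fourier_inversion:
  "(\<Sum>b\<in>UNIV. \<chi> (- (b * g)) * (\<Sum>x\<in>UNIV. F x * \<chi> (b * x))) = of_nat (p ^ n) * F g"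
proof -
  have "(\<Sum>b\<in>UNIV. \<chi> (- (b * g)) * (\<Sum>x\<in>UNIV. F x * \<chi> (b * x))) =
      (\<Sum>x\<in>UNIV. F x * (\<Sum>b\<in>UNIV. \<chi> (b * (x - g))))"
    unfolding sum_distrib_left
    by (subst sum.swap) (simp add: algebra_simps flip: chi_add)
  also have "\<dots> = (\<Sum>x\<in>UNIV. if x = g then of_nat (p ^ n) * F x else 0)"
    by (rule sum.cong) (simp_all add: sum_chi)
  finally show ?thesis
    by simp
qed

lemma fourier_inject:
  assumes "\<And>b. (\<Sum>x\<in>UNIV. F x * \<chi> (b * x)) = (\<Sum>x\<in>UNIV. G x * \<chi> (b * x))"
  shows "F g = G g"
  using fourier_inversion[of g F] fourier_inversion[of g G] p_pos by (simp add: assms)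

end

section \<open>Partial difference sets: Cayley graphs and a Fourier criterion\<close>

lemma srg_cayley_adj:
  fixes D :: "'a::{ab_group_add,finite} set"
  assumes D: "pds D v d lam mu" and sym: "\<And>x. x \<in> D \<Longrightarrow> - x \<in> D"
  shows "srg (cayley_adj D) v d lam mu"
proof -
  have adj_sym: "x - y \<in> D \<longleftrightarrow> y - x \<in> D" for x y
    using sym[of "x - y"] sym[of "y - x"] by auto
  have deg: "card {y. x - y \<in> D} = card D" for x
    by (rule bij_betw_same_card[of "\<lambda>y. x - y"], rule bij_betwI[of _ _ _ "\<lambda>y. x - y"]) auto
  \<comment> \<open>A common neighbour \<open>z\<close> corresponds to writing \<open>x - y\<close>
    as the difference of \<open>x - z\<close> and \<open>y - z\<close>.\<close>
  have common: "card {z. x - z \<in> D \<and> y - z \<in> D} = card {(u, w). u \<in> D \<and> w \<in> D \<and> u - w = x - y}"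
    for x y
    by (rule bij_betw_same_card[of "\<lambda>z. (x - z, y - z)"],
        rule bij_betwI[of _ _ _ "\<lambda>(u, w). x - u"]) (auto simp: algebra_simps)
  show ?thesis
    using D adj_sym unfolding srg_def pds_def cayley_adj_def deg common by auto
qed

context prime_power_field
begin

text \<open>By Fourier inversion the number of representations of \<open>g\<close> as a difference is
  \<open>s [g \<in> D] + t [g = 0] + mu\<close>.\<close>
lemma pds_if_fourier:
  fixes D :: "'a set" and s t mu :: real
  assumes sym: "\<And>x. x \<in> D \<Longrightarrow> - x \<in> D" and "0 \<notin> D"
    and quad: "\<And>b. (\<Sum>x\<in>D. \<chi> (b * x)) ^ 2 =
      of_real s * (\<Sum>x\<in>D. \<chi> (b * x)) + of_real t + (if b = 0 then of_real mu * of_nat (p ^ n) else 0)"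
  shows "pds D (real p ^ n) (real (card D)) (mu + s) mu"
proof -
  define N where "N = (\<lambda>g. card {(x, y). x \<in> D \<and> y \<in> D \<and> x - y = g})"
  \<comment> \<open>The predicted difference count. Its transform is the right-hand side of
    \<open>quad\<close>, so it suffices to compare transforms.\<close>
  define G :: "'a \<Rightarrow> complex" where
    "G = (\<lambda>g. (if g \<in> D then of_real s else 0) + (if g = 0 then of_real t else 0) + of_real mu)"
  have neg: "(\<Sum>x\<in>D. \<chi> (- (b * x))) = (\<Sum>x\<in>D. \<chi> (b * x))" for b
    by (rule sum.reindex_bij_witness[of _ uminus uminus]) (auto simp: sym)
  \<comment> \<open>The transform of the count is the product of the sums at \<open>b\<close> and
    \<open>- b\<close>, which is a square by the symmetry of \<open>D\<close>.\<close>
  have N_hat: "(\<Sum>g\<in>UNIV. of_nat (N g) * \<chi> (b * g)) = (\<Sum>x\<in>D. \<chi> (b * x)) ^ 2" for b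
  proof -
    have "(\<Sum>g\<in>UNIV. of_nat (N g) * \<chi> (b * g)) =
        (\<Sum>g\<in>UNIV. \<Sum>z\<in>{z \<in> D \<times> D. fst z - snd z = g}. \<chi> (b * (fst z - snd z)))"
    proof (rule sum.cong)
      fix g
      have "{(x, y). x \<in> D \<and> y \<in> D \<and> x - y = g} = {z \<in> D \<times> D. fst z - snd z = g}"
        by auto
      then show "of_nat (N g) * \<chi> (b * g) =
          (\<Sum>z\<in>{z \<in> D \<times> D. fst z - snd z = g}. \<chi> (b * (fst z - snd z)))"
        by (simp add: N_def)
    qed simp
    also have "\<dots> = (\<Sum>z\<in>D \<times> D. \<chi> (b * (fst z - snd z)))"
      by (rule sum.group) simp_all
    also have "\<dots> = (\<Sum>x\<in>D. \<Sum>y\<in>D. \<chi> (b * x) * \<chi> (- (b * y)))"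
      by (simp add: sum.cartesian_product case_prod_unfold algebra_simps flip: chi_add)
    also have "\<dots> = (\<Sum>x\<in>D. \<chi> (b * x)) ^ 2"
      by (simp add: power2_eq_square neg flip: sum_distrib_left sum_distrib_right)
    finally show ?thesis .
  qed
  have G_hat: "(\<Sum>g\<in>UNIV. G g * \<chi> (b * g)) = (\<Sum>x\<in>D. \<chi> (b * x)) ^ 2" for b
  proof -
    have "(\<Sum>g\<in>UNIV. G g * \<chi> (b * g)) = (\<Sum>g\<in>UNIV. if g \<in> D then of_real s * \<chi> (b * g) else 0)
        + (\<Sum>g\<in>UNIV. if g = 0 then of_real t * \<chi> (b * g) else 0)
        + of_real mu * (\<Sum>g\<in>UNIV. \<chi> (g * b))"
      unfolding sum_distrib_left sum.distrib[symmetric]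
      by (rule sum.cong) (simp_all add: G_def algebra_simps)
    then show ?thesis
      by (simp add: quad sum_chi sum.If_cases sum_distrib_left)
  qed
  have "complex_of_real (real (N g)) = G g" for g
    using fourier_inject[of "\<lambda>g. of_nat (N g)" G g] N_hat G_hat by simp
  then have "complex_of_real (real (N g)) = of_real ((if g \<in> D then s else 0) + mu)" if "g \<noteq> 0" for g
    using that by (simp add: G_def)
  then have N_eq: "real (N g) = (if g \<in> D then s else 0) + mu" if "g \<noteq> 0" for g
    using that of_real_eq_iff by blast
  then have "real (N g) = mu + s" if "g \<in> D" for g
    using that \<open>0 \<notin> D\<close> by (metis add.commute)
  moreover have "real (N g) = mu" if "g \<noteq> 0" "g \<notin> D" for g
    using that N_eq by simp
  ultimately show ?thesis
    using \<open>0 \<notin> D\<close> unfolding pds_def N_def by (simp add: card_UNIV)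
qed

section \<open>Squares and power maps in the prime subfield\<close>

lemma two_neq_0: "(2 :: 'a) \<noteq> 0"
proof -
  have "p > 2"
    using p_odd prime_gt_1_nat[OF p_prime] by (cases "p = 2") auto
  then show ?thesis
    using of_nat_eq_iff_mod[of 2 0] by simp
qed

lemma neg_eq_self_iff: "- x = (x :: 'a) \<longleftrightarrow> x = 0"
proof
  assume "- x = x"
  then have "x + x = 0"
    by (simp add: add_eq_0_iff)
  then show "x = 0"
    using two_neq_0 mult_eq_0_iff[of 2 x] by (simp only: mult_2) blast
qed simp

definition S :: "'a set" where
  "S = {s \<in> P. s \<noteq> 0 \<and> (\<exists>y\<in>P. y ^ 2 = s)}"

lemma S_subset: "S \<subseteq> P"
  by (auto simp: S_def)

lemma zero_notin_S [simp]: "0 \<notin> S"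
  by (simp add: S_def)

lemma card_S: "2 * card S = p - 1"
proof -
  \<comment> \<open>Squaring is two-to-one from the nonzero elements of \<open>P\<close> onto
    \<open>S\<close>.\<close>
  have "card (P - {0}) = (\<Sum>s\<in>S. card {y \<in> P - {0}. y ^ 2 = s})"
    unfolding card_eq_sum
    by (rule sum.group [symmetric]) (auto simp: S_def)
  also have "\<dots> = (\<Sum>s\<in>S. 2)"
  proof (rule sum.cong)
    fix s assume "s \<in> S"
    then obtain y where y: "y \<in> P" "y \<noteq> 0" "y ^ 2 = s"
      by (auto simp: S_def)
    then have "{y \<in> P - {0}. y ^ 2 = s} = {y, - y}"
      by (auto simp: power2_eq_iff)
    then show "card {y \<in> P - {0}. y ^ 2 = s} = 2"
      using neg_eq_self_iff[of y] y(2) by auto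
  qed simp
  finally show ?thesis
    by (simp add: card_P)
qed

lemma mult_square_S: "y \<in> P \<Longrightarrow> y \<noteq> 0 \<Longrightarrow> s \<in> S \<Longrightarrow> y ^ 2 * s \<in> S"
  by (auto simp: S_def simp flip: power_mult_distrib)

lemma P_power_pred: "\<beta> \<in> P \<Longrightarrow> \<beta> \<noteq> 0 \<Longrightarrow> \<beta> ^ (p - 1) = 1"
  using p_pos by (simp add: P_iff power_eq_if[of \<beta> p])

text \<open>The group of nonzero elements of \<open>P\<close> has exponent dividing
  \<open>p - 1\<close>, so the Bezout coefficient \<open>u\<close> of \<open>j\<close> inverts the
  power map.\<close>

lemma bij_betw_power_int:
  assumes "coprime j (int p - 1)"
  shows "bij_betw (\<lambda>\<beta>. \<beta> powi j) (P - {0}) (P - {0})"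
proof -
  obtain u w where uw: "u * j + w * (int p - 1) = 1"
    using assms bezout_int[of j "int p - 1"] by (auto simp: coprime_iff_gcd_eq_1)
  have recover: "(\<beta> powi j) powi u = \<beta>" if \<beta>: "\<beta> \<in> P" "\<beta> \<noteq> 0" for \<beta>
  proof -
    have "\<beta> powi (int p - 1) = 1"
      using P_power_pred[OF \<beta>] p_pos by (simp add: power_int_def nat_diff_distrib)
    then have "\<beta> powi (w * (int p - 1)) = 1"
      by (simp add: power_int_mult mult.commute[of w])
    moreover have "\<beta> = \<beta> powi (u * j + w * (int p - 1))"
      by (simp add: uw)
    ultimately show ?thesis
      using \<beta>(2) by (simp add: power_int_add power_int_mult mult.commute[of u])
  qed
  have "inj_on (\<lambda>\<beta>. \<beta> powi j) (P - {0})"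
    by (rule inj_on_inverseI[of _ "\<lambda>\<beta>. \<beta> powi u"]) (use recover in auto)
  moreover have "(\<lambda>\<beta>. \<beta> powi j) ` (P - {0}) \<subseteq> P - {0}"
    by auto
  ultimately show ?thesis
    by (simp add: bij_betw_def endo_inj_surj)
qed

end

section \<open>Character sums of a function satisfying Condition A\<close>

locale condition_A = prime_power_field p "2 * k" \<zeta> P
  for p k :: nat and \<zeta> :: complex and P :: "'a::{field,finite} set" +
  fixes f fs :: "'a \<Rightarrow> 'a" and \<epsilon> l :: int
  assumes f_P [simp]: "f x \<in> P" and f_0 [simp]: "f 0 = 0" and f_even: "f (- x) = f x"
    and coprime_l: "coprime (l - 1) (int p - 1)"
    and f_homog: "\<alpha> \<in> P \<Longrightarrow> \<alpha> \<noteq> 0 \<Longrightarrow> f (\<alpha> * x) = \<alpha> powi l * f x"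
    and eps: "\<epsilon> \<in> {1, -1}" and fs_P [simp]: "fs b \<in> P"
    and walsh: "walsh \<zeta> p (2 * k) f b = of_int \<epsilon> * of_nat p ^ k * \<zeta> ^ fp_ind p (fs b)"
begin

lemma k_pos: "k > 0"
  using n_pos by simp

text \<open>The factor \<open>\<epsilon> * int p ^ k\<close> of the Walsh value is an integer, so
  conjugation affects only the root of unity.\<close>

lemma sum_psi_f:
  assumes "\<alpha> \<in> P" "\<alpha> \<noteq> 0"
  shows "(\<Sum>x\<in>UNIV. \<psi> (\<alpha> * (f x + tr (b * x)))) = of_int (\<epsilon> * int p ^ k) * \<psi> (\<alpha> * fs b)"
  by (rule psi_sum_scale) (use assms walsh[of b] in \<open>simp_all add: walsh_def \<psi>_def tr_def [symmetric]\<close>)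

lemma even_l: "even l"
proof (rule ccontr)
  assume "odd l"
  \<comment> \<open>An odd \<open>l\<close> would make 2 a common divisor of \<open>l - 1\<close>
    and \<open>p - 1\<close>.\<close>
  then have "2 dvd l - 1" "2 dvd int p - 1"
    using p_odd by simp_all
  then have "is_unit (2 :: int)"
    using coprime_l coprime_common_divisor by blast
  then show False
    by simp
qed

lemma even_card_f_0: "even (card ({x. f x = 0} - {0}))"
proof -
  let ?A = "{x. f x = 0} - {0}"
  let ?C = "(\<lambda>x. {x, - x}) ` ?A"
  \<comment> \<open>The nonzero zeros of \<open>f\<close> split into the pairs
    \<open>{x, - x}\<close>, which have two elements in odd characteristic.\<close>
  have "2 * card ?C = card (\<Union>?C)"
  proof (rule card_partition)
    fix c assume "c \<in> ?C"
    then obtain x where x: "x \<noteq> 0" "c = {x, - x}"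
      by blast
    moreover from x have "x \<noteq> - x"
      using neg_eq_self_iff[of x] by metis
    ultimately show "card c = 2"
      by simp
  next
    fix c d assume "c \<in> ?C" "d \<in> ?C" "c \<noteq> d"
    then obtain x y where "c = {x, - x}" "d = {y, - y}" "{x, - x} \<noteq> {y, - y}"
      by blast
    then show "c \<inter> d = {}"
      by auto
  qed simp_all
  also have "\<Union>?C = ?A"
    by (auto simp: f_even)
  finally show ?thesis
    by (metis dvd_triv_left)
qed

text \<open>Counting the zeros of \<open>f\<close> by characters shows that otherwise their number is even, but
  \<open>x \<mapsto> - x\<close> fixes exactly one of them.\<close>
lemma fs_0: "fs 0 = 0"
proof (rule ccontr)
  assume nz: "fs 0 \<noteq> 0"
  let ?N = "card {x. f x = 0}"
  have "of_nat (p * ?N) = (\<Sum>x\<in>UNIV. \<Sum>\<alpha>\<in>P. \<psi> (\<alpha> * f x))"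
    by (simp add: sum_psi sum.If_cases)
  also have "\<dots> = (\<Sum>\<alpha>\<in>P. \<Sum>x\<in>UNIV. \<psi> (\<alpha> * f x))"
    by (rule sum.swap)
  also have "\<dots> = of_nat (p ^ (2 * k)) + (\<Sum>\<alpha>\<in>P - {0}. \<Sum>x\<in>UNIV. \<psi> (\<alpha> * f x))"
    by (subst sum.remove[of _ 0]) (simp_all add: card_UNIV)
  also have "(\<Sum>\<alpha>\<in>P - {0}. \<Sum>x\<in>UNIV. \<psi> (\<alpha> * f x)) =
      (\<Sum>\<alpha>\<in>P - {0}. of_int (\<epsilon> * int p ^ k) * \<psi> (\<alpha> * fs 0))"
    using sum_psi_f[of _ 0] by (intro sum.cong) simp_all
  also have "\<dots> = of_int (\<epsilon> * int p ^ k) * ((\<Sum>\<alpha>\<in>P. \<psi> (\<alpha> * fs 0)) - 1)"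
    by (simp add: sum_diff1 flip: sum_distrib_left)
  \<comment> \<open>By \<open>nz\<close> the complete sum over \<open>P\<close> vanishes, leaving -1
    for the omitted index 0.\<close>
  also have "\<dots> = - of_int (\<epsilon> * int p ^ k)"
    using nz by (simp add: sum_psi)
  finally have "(of_int (int (p * ?N)) :: complex) = of_int (int p ^ (2 * k) - \<epsilon> * int p ^ k)"
    by simp
  then have "int (p * ?N) = int p ^ (2 * k) - \<epsilon> * int p ^ k"
    by (simp only: of_int_eq_iff)
  moreover have "odd (int (p * ?N))"
  proof -
    have N: "?N = Suc (card ({x. f x = 0} - {0}))"
      by (rule card.remove) auto
    have "odd ?N"
      unfolding N using even_card_f_0 by simp
    then show ?thesis
      using p_odd by simp
  qed
  \<comment> \<open>This is a difference of two odd numbers.\<close>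
  moreover have "even (int p ^ (2 * k) - \<epsilon> * int p ^ k)"
    using eps p_odd by auto
  ultimately show False
    by metis
qed

text \<open>The exponent \<open>1 - l\<close> is chosen so that replacing \<open>x\<close> by
  \<open>\<beta> * x\<close> gives the \<open>f\<close> term and the trace term the same factor
  \<beta>; one conjugation then handles both.\<close>

lemma sum_psi_f_chi:
  assumes "\<beta> \<in> P" "\<beta> \<noteq> 0"
  shows "(\<Sum>x\<in>UNIV. \<psi> (\<beta> powi (1 - l) * f x) * \<chi> (b * x)) =
    of_int (\<epsilon> * int p ^ k) * \<psi> (\<beta> * fs b)"
proof -
  have "(\<Sum>x\<in>UNIV. \<psi> (\<beta> powi (1 - l) * f x) * \<chi> (b * x)) =
      (\<Sum>x\<in>UNIV. \<psi> (\<beta> powi (1 - l) * f (\<beta> * x)) * \<chi> (\<beta> * (b * x)))"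
    by (rule sum.reindex_bij_witness[of _ "\<lambda>x. \<beta> * x" "\<lambda>x. x / \<beta>"])
       (use assms in \<open>auto simp: mult.left_commute\<close>)
  also have "\<dots> = (\<Sum>x\<in>UNIV. \<psi> (\<beta> * (f x + tr (b * x))))"
  proof (rule sum.cong)
    fix x
    have "\<beta> powi (1 - l) * \<beta> powi l = \<beta>"
      using assms by (simp flip: power_int_add)
    then have "\<beta> powi (1 - l) * f (\<beta> * x) = \<beta> * f x"
      using assms by (simp add: f_homog flip: mult.assoc)
    then show "\<psi> (\<beta> powi (1 - l) * f (\<beta> * x)) * \<chi> (\<beta> * (b * x)) = \<psi> (\<beta> * (f x + tr (b * x)))"
      using assms by (simp add: \<chi>_def tr_scale distrib_left psi_add)
  qed simp
  also have "\<dots> = of_int (\<epsilon> * int p ^ k) * \<psi> (\<beta> * fs b)"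
    using assms by (rule sum_psi_f)
  finally show ?thesis .
qed

text \<open>As \<open>l\<close> is even, \<open>\<beta> powi (- l)\<close> is a square, so multiplication by it permutes \<open>S\<close>.\<close>
lemma sum_psi_S:
  assumes "\<beta> \<in> P" "\<beta> \<noteq> 0"
  shows "(\<Sum>s\<in>S. \<psi> (- (\<beta> powi (1 - l) * s))) = (\<Sum>s\<in>S. \<psi> (- (\<beta> * s)))"
proof -
  obtain m where m: "l = 2 * m"
    using even_l by blast
  define \<gamma> where "\<gamma> = \<beta> powi m"
  have \<gamma>: "\<gamma> \<in> P" "\<gamma> \<noteq> 0"
    using assms by (simp_all add: \<gamma>_def)
  have "\<beta> powi (1 - l) = \<beta> * (1 / \<gamma>) ^ 2"
    using assms by (simp add: \<gamma>_def m power_int_diff power_int_mult mult.commute[of 2] power_divide)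
  then have eq: "\<beta> powi (1 - l) * (\<gamma> ^ 2 * s) = \<beta> * s" for s
    using \<gamma> by (simp add: power_divide)
  show ?thesis
  proof (rule sum.reindex_bij_witness[of _ "\<lambda>s. \<gamma> ^ 2 * s" "\<lambda>s. (1 / \<gamma>) ^ 2 * s"])
    fix s assume "s \<in> S"
    show "(1 / \<gamma>) ^ 2 * s \<in> S" "\<gamma> ^ 2 * s \<in> S"
      using \<gamma> \<open>s \<in> S\<close> by (auto intro!: mult_square_S)
    show *: "\<gamma> ^ 2 * ((1 / \<gamma>) ^ 2 * s) = s" "(1 / \<gamma>) ^ 2 * (\<gamma> ^ 2 * s) = s"
      using \<gamma> by (simp_all add: power_divide)
    show "\<psi> (- (\<beta> * ((1 / \<gamma>) ^ 2 * s))) = \<psi> (- (\<beta> powi (1 - l) * s))"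
      using eq[of "(1 / \<gamma>) ^ 2 * s"] by (simp only: *)
  qed
qed

lemma fourier_D:
  "of_nat p * (\<Sum>x\<in>{x. f x \<in> S}. \<chi> (b * x)) =
    (if b = 0 then of_nat (card S * p ^ (2 * k)) else 0)
    + of_int (\<epsilon> * int p ^ k) * ((if fs b \<in> S then of_nat p else 0) - of_nat (card S))"
proof -
  \<comment> \<open>The contribution of the character with index \<alpha> when \<open>p\<close>
    times the indicator of \<open>S\<close>, evaluated at \<open>f x\<close>, is expanded in
    characters of \<open>P\<close>.\<close>
  define T where "T = (\<lambda>\<alpha>. (\<Sum>s\<in>S. \<psi> (- (\<alpha> * s))) * (\<Sum>x\<in>UNIV. \<psi> (\<alpha> * f x) * \<chi> (b * x)))"
  have detect: "(\<Sum>s\<in>S. \<Sum>\<alpha>\<in>P. \<psi> (\<alpha> * (y - s))) = (if y \<in> S then of_nat p else 0)" if "y \<in> P" for y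
  proof -
    have "(\<Sum>s\<in>S. \<Sum>\<alpha>\<in>P. \<psi> (\<alpha> * (y - s))) = (\<Sum>s\<in>S. if y = s then of_nat p else 0)"
      using that S_subset by (intro sum.cong) (auto simp: sum_psi card_P)
    then show ?thesis
      by simp
  qed
  have split: "\<psi> (\<alpha> * (y - s)) = \<psi> (- (\<alpha> * s)) * \<psi> (\<alpha> * y)" if "\<alpha> \<in> P" "s \<in> S" "y \<in> P" for \<alpha> s y
    using that S_subset psi_add[of "- (\<alpha> * s)" "\<alpha> * y"] by (auto simp: algebra_simps)
  have "of_nat p * (\<Sum>x\<in>{x. f x \<in> S}. \<chi> (b * x)) =
      (\<Sum>x\<in>UNIV. if f x \<in> S then of_nat p * \<chi> (b * x) else 0)"
    by (simp add: sum.If_cases sum_distrib_left)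
  also have "\<dots> = (\<Sum>x\<in>UNIV. (\<Sum>s\<in>S. \<Sum>\<alpha>\<in>P. \<psi> (\<alpha> * (f x - s))) * \<chi> (b * x))"
    by (rule sum.cong) (simp_all add: detect)
  also have "\<dots> = (\<Sum>x\<in>UNIV. \<Sum>s\<in>S. \<Sum>\<alpha>\<in>P. \<psi> (- (\<alpha> * s)) * (\<psi> (\<alpha> * f x) * \<chi> (b * x)))"
    unfolding sum_distrib_right by (intro sum.cong) (simp_all add: split mult.assoc)
  also have "\<dots> = (\<Sum>s\<in>S. \<Sum>\<alpha>\<in>P. \<Sum>x\<in>UNIV. \<psi> (- (\<alpha> * s)) * (\<psi> (\<alpha> * f x) * \<chi> (b * x)))"
    by (subst sum.swap, rule sum.cong, rule refl, rule sum.swap)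
  also have "\<dots> = (\<Sum>\<alpha>\<in>P. T \<alpha>)"
    unfolding T_def sum_product by (rule sum.swap)
  also have "\<dots> = T 0 + (\<Sum>\<alpha>\<in>P - {0}. T \<alpha>)"
    by (rule sum.remove) simp_all
  \<comment> \<open>The trivial character sees only \<open>b = 0\<close>.\<close>
  also have "T 0 = (if b = 0 then of_nat (card S * p ^ (2 * k)) else 0)"
    using sum_chi[of b] by (simp add: T_def mult.commute[of b])
  \<comment> \<open>Every nonzero \<alpha> is \<open>\<beta> powi (1 - l)\<close> for exactly one
    nonzero \<beta>, which brings the sum into the shape of \<open>sum_psi_f_chi\<close>.\<close>
  also have "(\<Sum>\<alpha>\<in>P - {0}. T \<alpha>) = (\<Sum>\<beta>\<in>P - {0}. T (\<beta> powi (1 - l)))"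
  proof (rule sum.reindex_bij_betw [symmetric], rule bij_betw_power_int)
    show "coprime (1 - l) (int p - 1)"
      using coprime_l coprime_minus_left_iff[of "l - 1" "int p - 1"] by simp
  qed
  also have "\<dots> = (\<Sum>\<beta>\<in>P - {0}. \<Sum>s\<in>S. of_int (\<epsilon> * int p ^ k) * \<psi> (\<beta> * (fs b - s)))"
  proof (rule sum.cong)
    fix \<beta> assume \<beta>: "\<beta> \<in> P - {0}"
    then show "T (\<beta> powi (1 - l)) = (\<Sum>s\<in>S. of_int (\<epsilon> * int p ^ k) * \<psi> (\<beta> * (fs b - s)))"
      unfolding T_def using sum_psi_S[of \<beta>] sum_psi_f_chi[of \<beta> b]
      by (simp add: split sum_distrib_left sum_distrib_right mult_ac)
  qed simp
  also have "\<dots> = of_int (\<epsilon> * int p ^ k) * (\<Sum>s\<in>S. \<Sum>\<beta>\<in>P - {0}. \<psi> (\<beta> * (fs b - s)))"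
    unfolding sum_distrib_left by (rule sum.swap)
  \<comment> \<open>Adding the index 0 completes the inner sum at the cost of 1 for each
    \<open>s\<close>, whence the term \<open>card S\<close>.\<close>
  also have "(\<Sum>s\<in>S. \<Sum>\<beta>\<in>P - {0}. \<psi> (\<beta> * (fs b - s))) =
      (\<Sum>s\<in>S. (\<Sum>\<beta>\<in>P. \<psi> (\<beta> * (fs b - s))) - 1)"
    by (simp add: sum_diff1)
  also have "\<dots> = (if fs b \<in> S then of_nat p else 0) - of_nat (card S)"
    by (simp add: sum_subtractf detect)
  finally show ?thesis .
qed

end

section \<open>The two nontrivial character values and the parameters\<close>

context condition_A
begin

text \<open>With \<open>m = card S\<close> and \<open>r = p ^ (k - 1)\<close>, this turns the
  remaining identities into polynomial ones in \<open>m\<close>, \<open>r\<close> and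
  \<epsilon>.\<close>

lemma of_nat_p_eq: "(of_nat p :: 'c::semiring_1) = 2 * of_nat (card S) + 1"
proof -
  have "p = 2 * card S + 1"
    using card_S p_pos by simp
  then show ?thesis
    by (metis of_nat_1 of_nat_add of_nat_mult of_nat_numeral)
qed

lemma p_power_k: "(of_nat p :: 'c::comm_semiring_1) ^ k = of_nat p * of_nat p ^ (k - 1)"
  using k_pos by (simp add: power_eq_if)

lemma fourier_D_real:
  fixes m r :: complex
  defines "m \<equiv> of_real (real (card S))" and "r \<equiv> of_real (real p ^ (k - 1))"
  shows "(\<Sum>x\<in>{x. f x \<in> S}. \<chi> (b * x)) =
    (if b = 0 then m * (2 * m + 1) * r ^ 2 else 0)
    + of_int \<epsilon> * r * ((if fs b \<in> S then 2 * m + 1 else 0) - m)"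
proof -
  define J where "J = (if fs b \<in> S then of_nat p else 0) - m"
  have r: "of_nat p ^ (k - 1) = r" and m: "of_nat (card S) = m"
    by (simp_all add: r_def m_def)
  have 1: "of_nat (card S * p ^ (2 * k)) = of_nat p * (m * of_nat p * r ^ 2)"
    unfolding of_nat_mult of_nat_power mult.commute[of 2 k] power_mult p_power_k r m
    by (simp add: power2_eq_square mult_ac)
  have 2: "of_int (\<epsilon> * int p ^ k) = of_nat p * (of_int \<epsilon> * r)"
    unfolding of_int_mult of_int_power of_int_of_nat_eq p_power_k r by (simp add: mult_ac)
  have "of_nat p * (\<Sum>x\<in>{x. f x \<in> S}. \<chi> (b * x)) =
      of_nat p * ((if b = 0 then m * of_nat p * r ^ 2 else 0) + of_int \<epsilon> * r * J)"
    unfolding fourier_D 1 2 m J_def[symmetric] by (simp add: distrib_left mult.assoc)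
  moreover have "(of_nat p :: complex) \<noteq> 0"
    using p_pos by simp
  ultimately have "(\<Sum>x\<in>{x. f x \<in> S}. \<chi> (b * x)) =
      (if b = 0 then m * of_nat p * r ^ 2 else 0) + of_int \<epsilon> * r * J"
    using mult_left_cancel by blast
  then show ?thesis
    unfolding J_def of_nat_p_eq m .
qed

lemma pds_D:
  defines "m \<equiv> real (card S)" and "r \<equiv> real p ^ (k - 1)"
  shows "pds {x. f x \<in> S} (real p ^ (2 * k)) (m * r * ((2 * m + 1) * r - of_int \<epsilon>))
    (m * r * (m * r - of_int \<epsilon>) + of_int \<epsilon> * r) (m * r * (m * r - of_int \<epsilon>))"
proof -
  have p2k: "of_nat (p ^ (2 * k)) = (2 * of_real m + 1) ^ 2 * complex_of_real r ^ 2"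
    unfolding of_nat_power mult.commute[of 2 k] power_mult p_power_k
    by (simp add: of_nat_p_eq r_def m_def power_mult_distrib)
  note D_hat = fourier_D_real[folded m_def r_def]
  \<comment> \<open>The character sum at \<open>b = 0\<close> counts the set, and
    \<open>fs 0 = 0\<close> lies outside \<open>S\<close>.\<close>
  have d: "real (card {x. f x \<in> S}) = m * r * ((2 * m + 1) * r - of_int \<epsilon>)"
  proof -
    have "complex_of_real (real (card {x. f x \<in> S})) =
        of_real (m * r * ((2 * m + 1) * r - of_int \<epsilon>))"
      using D_hat[of 0] by (simp add: fs_0) (simp add: algebra_simps power2_eq_square)
    then show ?thesis
      by (simp only: of_real_eq_iff)
  qed
  have "pds {x. f x \<in> S} (real p ^ (2 * k)) (real (card {x. f x \<in> S}))
    (m * r * (m * r - of_int \<epsilon>) + of_int \<epsilon> * r) (m * r * (m * r - of_int \<epsilon>))"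
  \<comment> \<open>For \<open>b \<noteq> 0\<close> the sum is
    \<open>\<epsilon> * r * (m + 1)\<close> or \<open>- \<epsilon> * r * m\<close>. These values add
    up to \<open>\<epsilon> * r\<close>, and the negative of their product is
    \<open>t\<close>.\<close>
  proof (rule pds_if_fourier[where t = "m * (m + 1) * r ^ 2"])
    fix b
    show "(\<Sum>x\<in>{x. f x \<in> S}. \<chi> (b * x)) ^ 2 =
        of_real (of_int \<epsilon> * r) * (\<Sum>x\<in>{x. f x \<in> S}. \<chi> (b * x)) + of_real (m * (m + 1) * r ^ 2)
        + (if b = 0 then of_real (m * r * (m * r - of_int \<epsilon>)) * of_nat (p ^ (2 * k)) else 0)"
      unfolding D_hat p2k using eps
      by (cases "b = 0"; cases "fs b \<in> S") (auto simp: fs_0 algebra_simps power2_eq_square)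
  qed (simp_all add: f_even)
  then show ?thesis
    by (simp only: d)
qed

end

section \<open>Translation of the parameters back to \<open>p\<close> and \<open>k\<close>\<close>

theorem theorem2:
  fixes f :: "'a::{field,finite} \<Rightarrow> 'a" and p k :: nat and \<epsilon> :: int and \<zeta> :: complex
  assumes card: "card (UNIV :: 'a set) = p ^ (2 * k)"
    and zeta: "\<zeta> ^ p = 1" "\<zeta> \<noteq> 1"
    and A: "conditionA \<zeta> p k f \<epsilon>"
  defines "DS \<equiv> {x. x \<noteq> 0 \<and> f x \<noteq> 0 \<and> (\<exists>y\<in>prime_subfield p. y ^ 2 = f x)}"
  defines "q \<equiv> real p ^ k - real p ^ (k - 1)"
  shows "pds DS (real p ^ (2 * k)) ((1/2) * q * (real p ^ k - of_int \<epsilon>))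
           ((1/4) * q ^ 2 - (3 * of_int \<epsilon> / 2) * q + of_int \<epsilon> * real p ^ k)
           ((1/2) * q * ((1/2) * q - of_int \<epsilon>))
       \<and> srg (cayley_adj DS) (real p ^ (2 * k)) ((1/2) * q * (real p ^ k - of_int \<epsilon>))
           ((1/4) * q ^ 2 - (3 * of_int \<epsilon> / 2) * q + of_int \<epsilon> * real p ^ k)
           ((1/2) * q * ((1/2) * q - of_int \<epsilon>))"
proof -
  define P :: "'a set" where "P = prime_subfield p"
  obtain fs l where fsl: "\<And>b. fs b \<in> P"
      "\<And>b. walsh \<zeta> p (2 * k) f b = of_int \<epsilon> * of_nat p ^ k * \<zeta> ^ fp_ind p (fs b)"
      "gcd (l - 1) (int p - 1) = 1"
      "\<And>\<alpha> x. \<alpha> \<in> P \<Longrightarrow> \<alpha> \<noteq> 0 \<Longrightarrow> f (\<alpha> * x) = \<alpha> powi l * f x"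
    using A unfolding conditionA_def P_def by metis
  interpret condition_A p k \<zeta> P f fs \<epsilon> l
    using A card zeta fsl
    by unfold_locales (auto simp: conditionA_def P_def coprime_iff_gcd_eq_1)
  define m where "m = real (card S)"
  define r where "r = real p ^ (k - 1)"
  have "real p = 2 * m + 1"
    by (simp add: m_def of_nat_p_eq)
  moreover have "real p ^ k = real p * r"
    unfolding r_def by (rule p_power_k)
  ultimately have pk: "real p ^ k = (2 * m + 1) * r"
    by simp
  \<comment> \<open>Since \<open>p - 1 = 2 * m\<close>, the halves and quarters in the stated
    parameters cancel.\<close>
  then have q: "q = 2 * m * r"
    by (simp add: q_def r_def algebra_simps)
  have DS: "DS = {x. f x \<in> S}"
    unfolding DS_def S_def using P_def by auto
  have d: "(1/2) * q * (real p ^ k - of_int \<epsilon>) = m * r * ((2 * m + 1) * r - of_int \<epsilon>)"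
    by (simp add: pk q)
  have lam: "(1/4) * q ^ 2 - (3 * of_int \<epsilon> / 2) * q + of_int \<epsilon> * real p ^ k =
      m * r * (m * r - of_int \<epsilon>) + of_int \<epsilon> * r"
    unfolding pk q by (simp add: power2_eq_square algebra_simps)
  have mu: "(1/2) * q * ((1/2) * q - of_int \<epsilon>) = m * r * (m * r - of_int \<epsilon>)"
    by (simp add: q)
  have "pds DS (real p ^ (2 * k)) (m * r * ((2 * m + 1) * r - of_int \<epsilon>))
      (m * r * (m * r - of_int \<epsilon>) + of_int \<epsilon> * r) (m * r * (m * r - of_int \<epsilon>))"
    unfolding DS m_def r_def by (rule pds_D)
  moreover have "- x \<in> DS" if "x \<in> DS" for x
    using that by (simp add: DS f_even)
  ultimately show ?thesis
    unfolding d lam mu using srg_cayley_adj by blast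
qed

end
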